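(* Let $\phi:\mathbb{R}^n\to\mathbb{R}$ be convex and $1/\gamma$ smooth, let $g:\mathbb{R}^m\to\mathbb{R}\cup\{+\infty\}$ be convex and $\lambda$ strongly convex (with $\gamma,\lambda>0$), let $A\in\mathbb{R}^{n\times n}$ be a square invertible matrix, and let $B\in\mathbb{R}^{n\times m}$, $c\in\mathbb{R}^n$, $\rho>0$. Let $G\in\mathbb{R}^{m\times m}$ and $H\in\mathbb{R}^{n\times n}$ be symmetric positive semi-definite, and write $H=A^\top\tilde H A$ with $\tilde H\in\mathbb{R}^{n\times n}$ symmetric positive semi-definite. Let $\sigma_{\min}(H)$ be the smallest eigenvalue of $H$ and $\sigma_{\max}(\tilde H)$ the largest eigenvalue of $\tilde H$, and assume $\sigma_{\min}(H)\ge\gamma^{-1}$. Let $\sigma_{\min}(A)$ be the smallest eigenvalue of $(AA^\top)^{1/2}$, and let $\sigma_{\max}(B)$, $\sigma_{\max}(G)$ be the largest singular values of $B$ and $G$. Let $s\in[0,1)$ and $\theta>0$ satisfy $$\theta\le\min\left(\frac{\rho\,\sigma_{\min}(A)^2}{\sigma_{\min}(H)},\ \frac{s\rho}{\sigma_{\max}(\tilde H)},\ \frac{(1-s)\lambda}{(\rho+\sigma_{\max}(\tilde H))\sigma_{\max}(B)^2+(1-s)\rho\,\sigma_{\max}(G)}\right).$$ Let $(v^t,w^t,\alpha^t)_{t\ge1}$ be generated from arbitrary $w^0\in\mathbb{R}^n$, $v^0\in\mathbb{R}^m$, $\alpha^0\in\mathbb{R}^n$ by the preconditioned linearized ADMM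 algorithm (defined in the context), and let $\tilde\alpha^t=\alpha^t+\tilde HA(w^t-w^{t-1})$ for $t\ge1$. Then for any $(\alpha,v)\in\mathbb{R}^n\times\mathbb{R}^m$ and $w=\nabla\phi^*(-A^\top\alpha)$, and every $T\ge1$, $$\sum_{t=1}^T(1+\theta)^{t-T}r_t\le(1+\theta)^{-T}\delta_0-\delta_T,\qquad \sum_{t=1}^T(1+\theta)^{t-T}r_t^*\le(1+\theta)^{-T}\delta_0-\delta_T,$$ where $$r_t=\phi(w^{t-1})+g(v^t)-\phi(w)-g(v)-(\tilde\alpha^t)^\top(Aw-Bv-c)+\alpha^\top(Aw^{t-1}-Bv^t-c),$$ $$r_t^*=\phi^*(-A^\top\tilde\alpha^t)+g(v^t)-\phi^*(-A^\top\alpha)-g(v)+(\tilde\alpha^t)^\top(Bv+c)-\alpha^\top(Bv^t+c),$$ $$\delta_t=\frac12\left[\|Aw^t-Bv-c\|_{\tilde H}^2+\rho\|Aw^t-Bv-c\|_2^2+\rho(1+\theta)\|v^t-v\|_G^2+\frac{1+\theta}{\rho}\|\alpha^t-\alpha\|_2^2\right].$$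
   Context: For a symmetric positive semi-definite matrix $M$, $\|x\|_M^2=x^\top Mx$. The problem is $\min_{w,v}[\phi(w)+g(v)]$ subject to $Aw-Bv=c$. Preconditioned linearized ADMM: with $$\phi_H(w^{t-1};w)=\phi(w^{t-1})+\nabla\phi(w^{t-1})^\top(w-w^{t-1})+\tfrac12(w-w^{t-1})^\top H(w-w^{t-1}),$$ given $w^0,v^0,\alpha^0$, for $t=1,2,\ldots$, $$v^t=\arg\min_v\Big[g(v)-(\alpha^{t-1})^\top Bv+\tfrac{\rho}{2}\|Aw^{t-1}-Bv-c\|_2^2+\tfrac{\rho}{2}\|v-v^{t-1}\|_G^2\Big],$$ $$w^t=\arg\min_w\Big[\phi_H(w^{t-1};w)+(\alpha^{t-1})^\top Aw+\tfrac{\rho}{2}\|Aw-Bv^t-c\|_2^2\Big],$$ $$\alpha^t=\alpha^{t-1}+\rho(Aw^t-Bv^t-c).$$ The minimizers are assumed to exist. For a convex function $h$, $h^*(\beta)=\sup_u[\beta^\top u-h(u)]$ is the convex conjugate, and $D_h(u',u)=h(u)-h(u')-\nabla h(u')^\top(u-u')$ is the Bregman divergence. "$\phi$ is $1/\gamma$ smooth" means $\phi$ is differentiable with $D_\phi(w',w)\le\frac{1}{2\gamma}\|w'-w\|_2^2$ for all $w,w'$. "$g$ is $\lambda$ strongly convex" means $D_g(v',v)\ge\frac{\lambda}{2}\|v'-v\|_2^2$ for all $v,v'$; $g$ may be nondifferentiable or take the value $+\infty$ (but is not identically $+\infty$), in which case $\nabla g(v')$ stands for any subgradient at $v'$. Likewise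 $w=\nabla\phi^*(-A^\top\alpha)$ means that $w$ is a (sub)gradient of $\phi^*$ at $-A^\top\alpha$, equivalently $\nabla\phi(w)=-A^\top\alpha$; the claim is for those $\alpha$ for which such a $w$ exists. A fraction with zero denominator in the bound on $\theta$ is read as $+\infty$. *)

theory Defs
  imports "HOL-Analysis.Analysis"
begin

section \<open>Convex analysis for extended-real-valued functions\<close>

definition proper_fun :: "('a \<Rightarrow> ereal) \<Rightarrow> bool" where
  "proper_fun h \<longleftrightarrow> (\<forall>x. h x \<noteq> -\<infinity>) \<and> (\<exists>x. h x \<noteq> \<infinity>)"

text \<open>At the endpoints \<open>u = 0, 1\<close> the convention \<open>0 * \<infinity> = 0\<close> of \<^typ>\<open>ereal\<close> makes the
  condition trivial.\<close>
definition convex_ereal :: "('a::real_vector \<Rightarrow> ereal) \<Rightarrow> bool" where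
  "convex_ereal h \<longleftrightarrow> (\<forall>x y u. 0 \<le> u \<and> u \<le> 1 \<longrightarrow>
     h ((1 - u) *\<^sub>R x + u *\<^sub>R y) \<le> ereal (1 - u) * h x + ereal u * h y)"

definition convex_conjugate :: "('a::real_inner \<Rightarrow> ereal) \<Rightarrow> 'a \<Rightarrow> ereal" where
  "convex_conjugate h \<beta> = (SUP u. ereal (\<beta> \<bullet> u) - h u)"

definition subgradient :: "('a::real_inner \<Rightarrow> ereal) \<Rightarrow> 'a \<Rightarrow> 'a \<Rightarrow> bool" where
  "subgradient h x p \<longleftrightarrow> \<bar>h x\<bar> \<noteq> \<infinity> \<and> (\<forall>y. h x + ereal (p \<bullet> (y - x)) \<le> h y)"

definition gradient :: "('a::real_inner \<Rightarrow> real) \<Rightarrow> 'a \<Rightarrow> 'a" where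
  "gradient f x = (THE p. GDERIV f x :> p)"

text \<open>The Bregman divergence \<open>D\<^sub>h(u', u)\<close>, with base point \<open>u'\<close>; the vector \<open>p\<close> plays the role of
  the (sub)gradient of \<open>h\<close> at \<open>u'\<close>.\<close>
definition bregman :: "('a::real_inner \<Rightarrow> ereal) \<Rightarrow> 'a \<Rightarrow> 'a \<Rightarrow> 'a \<Rightarrow> ereal" where
  "bregman h p u' u = h u - h u' - ereal (p \<bullet> (u - u'))"

definition smooth_fun :: "real \<Rightarrow> ('a::real_inner \<Rightarrow> real) \<Rightarrow> bool" where
  "smooth_fun L f \<longleftrightarrow> (\<forall>x. f differentiable (at x)) \<and>
     (\<forall>w w'. bregman (\<lambda>x. ereal (f x)) (gradient f w') w' w \<le> ereal (L / 2 * (norm (w' - w))\<^sup>2))"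

definition strongly_convex :: "real \<Rightarrow> ('a::real_inner \<Rightarrow> ereal) \<Rightarrow> bool" where
  "strongly_convex l h \<longleftrightarrow>
     (\<forall>v v' p. subgradient h v' p \<longrightarrow> ereal (l / 2 * (norm (v' - v))\<^sup>2) \<le> bregman h p v' v)"

section \<open>Matrices\<close>

definition sym_psd :: "real^'n^'n \<Rightarrow> bool" where
  "sym_psd M \<longleftrightarrow> transpose M = M \<and> (\<forall>x. 0 \<le> x \<bullet> (M *v x))"

definition normsq :: "real^'n^'n \<Rightarrow> real^'n \<Rightarrow> real" where
  "normsq M x = x \<bullet> (M *v x)"

definition eigenvalues :: "real^'n^'n \<Rightarrow> real set" where
  "eigenvalues M = {k. \<exists>x. x \<noteq> 0 \<and> M *v x = k *\<^sub>R x}"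

definition min_eigenvalue :: "real^'n^'n \<Rightarrow> real" where
  "min_eigenvalue M = Min (eigenvalues M)"

definition max_eigenvalue :: "real^'n^'n \<Rightarrow> real" where
  "max_eigenvalue M = Max (eigenvalues M)"

definition psd_sqrt :: "real^'n^'n \<Rightarrow> real^'n^'n" where
  "psd_sqrt M = (THE R. sym_psd R \<and> R ** R = M)"

definition singular_values :: "real^'m^'n \<Rightarrow> real set" where
  "singular_values M = sqrt ` eigenvalues (transpose M ** M)"

definition max_singular_value :: "real^'m^'n \<Rightarrow> real" where
  "max_singular_value M = Max (singular_values M)"

section \<open>Preconditioned linearized ADMM\<close>

text \<open>Fraction of reals in which a zero denominator yields \<open>+\<infinity>\<close>.\<close>
definition frac_inf :: "real \<Rightarrow> real \<Rightarrow> ereal" where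
  "frac_inf a b = (if b = 0 then \<infinity> else ereal (a / b))"

definition quad_model :: "(real^'n \<Rightarrow> real) \<Rightarrow> real^'n^'n \<Rightarrow> real^'n \<Rightarrow> real^'n \<Rightarrow> real" where
  "quad_model \<phi> H w' w =
     \<phi> w' + gradient \<phi> w' \<bullet> (w - w') + 1 / 2 * ((w - w') \<bullet> (H *v (w - w')))"

text \<open>The sequences \<open>w\<close>, \<open>v\<close>, \<open>a\<close> (the last one being the dual variable) form a run of the
  algorithm started from \<open>w 0\<close>, \<open>v 0\<close>, \<open>a 0\<close>.\<close>
definition pladmm ::
  "(real^'n \<Rightarrow> real) \<Rightarrow> (real^'m \<Rightarrow> ereal) \<Rightarrow> real^'n^'n \<Rightarrow> real^'m^'n \<Rightarrow> real^'n \<Rightarrow> real \<Rightarrow>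
   real^'m^'m \<Rightarrow> real^'n^'n \<Rightarrow>
   (nat \<Rightarrow> real^'n) \<Rightarrow> (nat \<Rightarrow> real^'m) \<Rightarrow> (nat \<Rightarrow> real^'n) \<Rightarrow> bool" where
  "pladmm \<phi> g A B c \<rho> G H w v a \<longleftrightarrow> (\<forall>t\<ge>1.
     is_arg_min
       (\<lambda>x. g x + ereal (- (a (t - 1) \<bullet> (B *v x))
                   + \<rho> / 2 * (norm (A *v w (t - 1) - B *v x - c))\<^sup>2
                   + \<rho> / 2 * normsq G (x - v (t - 1))))
       (\<lambda>_. True) (v t) \<and>
     is_arg_min
       (\<lambda>x. quad_model \<phi> H (w (t - 1)) x + a (t - 1) \<bullet> (A *v x)
            + \<rho> / 2 * (norm (A *v x - B *v v t - c))\<^sup>2)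
       (\<lambda>_. True) (w t) \<and>
     a t = a (t - 1) + \<rho> *\<^sub>R (A *v w t - B *v v t - c))"

end

(*
  Every step of the algorithm satisfies r_t, r*_t <= R_t <= delta_(t-1) / (1 + theta) - delta_t for
  a common R_t, and these bounds telescope. Optimality of w^t says that the gradient of phi at
  w^(t-1) is -A^T alphatilde^t, so both gaps are bounded by means of cocoercivity of the gradient
  of phi, in one or the other direction, which leaves the negative term
  -Q = -(gamma/2) |A^T (alphatilde^t - alpha)|^2. As H >= 1/gamma, writing alpha^t - alpha = Ht e
  gives 2 Q >= |e + A (w^t - w^(t-1))|^2 in the seminorm of Ht; this absorbs the cross terms and
  leaves -|e|_Ht^2, which pays for the dual part of the contraction. The primal part is paid for by
  the strong convexity of g and the square completed from the constraint residual.
*)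
theory Submission
  imports Defs
begin

section \<open>Gradients, subgradients and first-order optimality\<close>

text \<open>Riesz representation: the derivative is a linear functional, represented by its adjoint
  at 1. Uniqueness of the derivative then makes the description inside \<open>gradient\<close> well
  defined.\<close>

lemma GDERIV_gradient:
  fixes f :: "'a::euclidean_space \<Rightarrow> real"
  assumes "f differentiable (at x)"
  shows "GDERIV f x :> gradient f x"
proof -
  obtain f' where f': "(f has_derivative f') (at x)"
    using assms unfolding differentiable_def by blast
  interpret bounded_linear f' using f' by (rule has_derivative_bounded_linear)
  have "f' h = h \<bullet> adjoint f' 1" for h
    using adjoint_works[OF linear_axioms, of h 1] by simp
  then have "GDERIV f x :> adjoint f' 1"
    using f' unfolding gderiv_def by (metis (no_types, lifting) ext)
  moreover have "q = p" if "GDERIV f x :> p" "GDERIV f x :> q" for p q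
  proof -
    have "(\<lambda>h. h \<bullet> p) = (\<lambda>h. h \<bullet> q)"
      using that has_derivative_unique unfolding gderiv_def by blast
    then have "(q - p) \<bullet> p = (q - p) \<bullet> q" by (rule fun_cong)
    then have "(q - p) \<bullet> (q - p) = 0" by (simp add: inner_diff_right)
    then show ?thesis by simp
  qed
  ultimately show ?thesis
    unfolding gradient_def by (metis (no_types, lifting) theI)
qed

text \<open>Fermat's rule for a nonsmooth convex part plus a differentiable part. Along the segment
  from \<open>x\<close> to \<open>y\<close> convexity makes the change of \<open>g\<close> at most
  linear, while the difference quotient of \<open>q\<close> tends to
  \<open>p \<bullet> (y - x)\<close>.\<close>

lemma subgradient_of_minimizer:
  fixes g :: "'a::real_inner \<Rightarrow> ereal" and q :: "'a \<Rightarrow> real"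
  assumes conv: "convex_ereal g" and proper: "proper_fun g" and fin: "\<bar>g x\<bar> \<noteq> \<infinity>"
    and q: "GDERIV q x :> p"
    and min: "\<And>y. g x + ereal (q x) \<le> g y + ereal (q y)"
  shows "subgradient g x (- p)"
  unfolding subgradient_def
proof (intro conjI allI)
  show "\<bar>g x\<bar> \<noteq> \<infinity>" by fact
  fix y
  obtain gx where gx: "g x = ereal gx" using fin by auto
  show "g x + ereal (- p \<bullet> (y - x)) \<le> g y"
  proof (cases "g y")
    case (real gy)
    define z where "z u = x + u *\<^sub>R (y - x)" for u :: real
    have ineq: "gx - gy \<le> (q (z u) - q (z 0)) / u" if u: "0 < u" "u \<le> 1" for u
    proof -
      have "g x + ereal (q x) \<le> g (z u) + ereal (q (z u))" by (rule min)
      also have "z u = (1 - u) *\<^sub>R x + u *\<^sub>R y" by (simp add: z_def algebra_simps)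
      also have "g \<dots> \<le> ereal (1 - u) * g x + ereal u * g y"
        using conv u unfolding convex_ereal_def by simp
      finally have "gx + q x \<le> (1 - u) * gx + u * gy + q (z u)"
        by (simp add: gx real z_def algebra_simps add_right_mono)
      then show ?thesis using u by (simp add: z_def field_simps)
    qed
    have "((\<lambda>u. q (z u)) has_derivative (\<lambda>h. (h *\<^sub>R (y - x)) \<bullet> p)) (at 0)"
    proof (rule has_derivative_compose[where f = z, unfolded o_def])
      show "(z has_derivative (\<lambda>h. h *\<^sub>R (y - x))) (at 0)"
        unfolding z_def by (auto intro!: derivative_eq_intros)
      show "(q has_derivative (\<lambda>h. h \<bullet> p)) (at (z 0))"
        using q by (simp add: z_def gderiv_def)
    qed
    then have "((\<lambda>u. q (z u)) has_real_derivative (p \<bullet> (y - x))) (at 0)"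
      by (rule has_derivative_imp_has_field_derivative) (simp add: inner_commute)
    then have "((\<lambda>u. (q (z u) - q (z 0)) / u) \<longlongrightarrow> p \<bullet> (y - x)) (at 0)"
      by (simp add: DERIV_def)
    \<comment> \<open>The inequality \<open>ineq\<close> holds only for positive \<open>u\<close>,
      so the limit is taken from the right.\<close>
    then have "((\<lambda>u. (q (z u) - q (z 0)) / u) \<longlongrightarrow> p \<bullet> (y - x)) (at_right 0)"
      by (rule tendsto_mono[OF at_le, rotated]) simp
    moreover have "\<forall>\<^sub>F u in at_right 0. gx - gy \<le> (q (z u) - q (z 0)) / u"
      unfolding eventually_at_right_field using ineq by (intro exI[of _ 1]) auto
    ultimately have "gx - gy \<le> p \<bullet> (y - x)"
      by (rule tendsto_lowerbound) simp
    then show ?thesis by (simp add: gx real)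
  qed (use proper in \<open>auto simp: proper_fun_def\<close>)
qed

lemma gradient_zero_at_minimum:
  fixes q :: "'a::real_inner \<Rightarrow> real"
  assumes "GDERIV q x :> p" and "\<And>y. q x \<le> q y"
  shows "p = 0"
proof -
  have "subgradient (\<lambda>_. 0) x (- p)"
    by (rule subgradient_of_minimizer[OF _ _ _ assms(1)])
      (auto simp: convex_ereal_def proper_fun_def assms(2))
  then have "ereal (- p \<bullet> (y - x)) \<le> 0" for y
    by (simp add: subgradient_def)
  \<comment> \<open>Moving against the gradient turns the subgradient inequality into a bound on
    \<open>p \<bullet> p\<close>.\<close>
  from this[of "x - p"] have "p \<bullet> p \<le> 0" by simp
  then have "p \<bullet> p = 0" using inner_ge_zero order.antisym by blast
  then show ?thesis by simp
qed

section \<open>Smooth convex functions and their conjugates\<close>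

text \<open>Every point minimises the zero function \<open>f + (- f)\<close>, so Fermat's rule with
  convex part \<open>f\<close> and differentiable part \<open>- f\<close> makes \<open>p\<close> a
  subgradient.\<close>

lemma convex_on_tangent_le:
  fixes f :: "'a::real_inner \<Rightarrow> real"
  assumes conv: "convex_on UNIV f" and f: "GDERIV f x :> p"
  shows "f x + p \<bullet> (y - x) \<le> f y"
proof -
  have "subgradient (\<lambda>x. ereal (f x)) x (- (- p))"
  proof (rule subgradient_of_minimizer)
    show "convex_ereal (\<lambda>x. ereal (f x))"
      using conv by (auto simp: convex_ereal_def convex_on_def intro!: convex_onD)
    show "GDERIV (\<lambda>x. - f x) x :> - p" using f by (rule GDERIV_minus)
  qed (auto simp: proper_fun_def)
  then show ?thesis by (simp add: subgradient_def)
qed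

lemma smooth_fun_upper:
  fixes \<phi> :: "'a::real_inner \<Rightarrow> real"
  assumes "smooth_fun L \<phi>"
  shows "\<phi> y \<le> \<phi> x + gradient \<phi> x \<bullet> (y - x) + L / 2 * (norm (y - x))\<^sup>2"
proof -
  have "bregman (\<lambda>x. ereal (\<phi> x)) (gradient \<phi> x) x y \<le> ereal (L / 2 * (norm (x - y))\<^sup>2)"
    using assms unfolding smooth_fun_def by blast
  then show ?thesis by (simp add: bregman_def norm_minus_commute)
qed

text \<open>Compare the tangent at \<open>x\<close> with the quadratic upper bound at \<open>y\<close> in the point minimising
  their difference, a gradient step away from \<open>y\<close>.\<close>
lemma smooth_convex_lower:
  fixes \<phi> :: "'a::euclidean_space \<Rightarrow> real"
  assumes "\<gamma> > 0" and conv: "convex_on UNIV \<phi>" and smooth: "smooth_fun (1 / \<gamma>) \<phi>"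
  shows "\<phi> x + gradient \<phi> x \<bullet> (y - x) + \<gamma> / 2 * (norm (gradient \<phi> y - gradient \<phi> x))\<^sup>2 \<le> \<phi> y"
proof -
  define e where "e = gradient \<phi> y - gradient \<phi> x"
  define z where "z = y - \<gamma> *\<^sub>R e"
  have "GDERIV \<phi> x :> gradient \<phi> x"
    using smooth by (intro GDERIV_gradient) (simp add: smooth_fun_def)
  then have "\<phi> x + gradient \<phi> x \<bullet> (z - x) \<le> \<phi> z"
    by (rule convex_on_tangent_le[OF conv])
  also have "\<dots> \<le> \<phi> y + gradient \<phi> y \<bullet> (z - y) + (1 / \<gamma>) / 2 * (norm (z - y))\<^sup>2"
    by (rule smooth_fun_upper[OF smooth])
  finally have 1: "\<phi> x + gradient \<phi> x \<bullet> (z - x) - gradient \<phi> y \<bullet> (z - y) - \<gamma> / 2 * (norm e)\<^sup>2 \<le> \<phi> y"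
    using \<open>\<gamma> > 0\<close> by (simp add: z_def power2_eq_square field_simps)
  have "gradient \<phi> x \<bullet> (z - x) - gradient \<phi> y \<bullet> (z - y) = gradient \<phi> x \<bullet> (y - x) - e \<bullet> (z - y)"
    by (simp add: e_def inner_diff_left inner_diff_right)
  also have "\<dots> = gradient \<phi> x \<bullet> (y - x) + \<gamma> * (norm e)\<^sup>2"
    by (simp add: z_def power2_norm_eq_inner)
  finally show ?thesis using 1 by (simp add: e_def)
qed

text \<open>At a gradient the supremum defining the conjugate is attained at the base point: the
  tangent inequality bounds all other terms.\<close>

lemma convex_conjugate_gradient:
  fixes \<phi> :: "'a::euclidean_space \<Rightarrow> real"
  assumes conv: "convex_on UNIV \<phi>" and "\<phi> differentiable (at x)"
  shows "convex_conjugate (\<lambda>u. ereal (\<phi> u)) (gradient \<phi> x) = ereal (gradient \<phi> x \<bullet> x - \<phi> x)"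
  unfolding convex_conjugate_def
proof (rule antisym)
  show "(SUP u. ereal (gradient \<phi> x \<bullet> u) - ereal (\<phi> u)) \<le> ereal (gradient \<phi> x \<bullet> x - \<phi> x)"
  proof (rule SUP_least)
    fix u
    show "ereal (gradient \<phi> x \<bullet> u) - ereal (\<phi> u) \<le> ereal (gradient \<phi> x \<bullet> x - \<phi> x)"
      using convex_on_tangent_le[OF conv GDERIV_gradient[OF assms(2)], of u]
      by (simp add: inner_diff_right)
  qed
  show "ereal (gradient \<phi> x \<bullet> x - \<phi> x) \<le> (SUP u. ereal (gradient \<phi> x \<bullet> u) - ereal (\<phi> u))"
    by (rule SUP_upper2[of x]) auto
qed

text \<open>Testing the subgradient inequality of the conjugate at \<open>gradient \<phi> w\<close> gives the equality
  case of Fenchel--Young.\<close>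
lemma subgradient_convex_conjugate:
  fixes \<phi> :: "'a::euclidean_space \<Rightarrow> real"
  assumes conv: "convex_on UNIV \<phi>" and diff: "\<phi> differentiable (at w)"
    and sub: "subgradient (convex_conjugate (\<lambda>x. ereal (\<phi> x))) \<beta> w"
  shows "gradient \<phi> w = \<beta>"
proof -
  let ?C = "convex_conjugate (\<lambda>x. ereal (\<phi> x))"
  obtain k where k: "?C \<beta> = ereal k" using sub by (auto simp: subgradient_def)
  have "?C \<beta> + ereal (w \<bullet> (gradient \<phi> w - \<beta>)) \<le> ?C (gradient \<phi> w)"
    using sub by (simp add: subgradient_def)
  then have *: "k \<le> w \<bullet> \<beta> - \<phi> w"
    by (simp add: k convex_conjugate_gradient[OF conv diff] inner_diff_right inner_commute)
  have conj: "\<beta> \<bullet> u - \<phi> u \<le> k" for u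
  proof -
    have "ereal (\<beta> \<bullet> u) - ereal (\<phi> u) \<le> ?C \<beta>"
      unfolding convex_conjugate_def by (rule SUP_upper) simp
    then show ?thesis by (simp add: k)
  qed
  \<comment> \<open>The two bounds on \<open>k\<close> make \<open>w\<close> a minimiser of the
    tilted function, whose gradient must therefore vanish.\<close>
  have le: "\<phi> w - w \<bullet> \<beta> \<le> \<phi> u - u \<bullet> \<beta>" for u
    using * conj[of u] by (simp add: inner_commute)
  have "GDERIV (\<lambda>u. \<phi> u - u \<bullet> \<beta>) w :> gradient \<phi> w - \<beta>"
    using GDERIV_gradient[OF diff] unfolding gderiv_def
    by (auto intro!: derivative_eq_intros simp: inner_diff_right)
  from gradient_zero_at_minimum[OF this le] show ?thesis by simp
qed

section \<open>Quadratic forms, eigenvalues and singular values\<close>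

lemma inner_matrix_vector_transpose:
  fixes M :: "real^'n^'m"
  shows "x \<bullet> (M *v y) = (transpose M *v x) \<bullet> y"
  by (simp add: dot_lmul_matrix transpose_matrix_vector)

lemma symmetric_inner:
  fixes M :: "real^'n^'n"
  assumes "transpose M = M"
  shows "x \<bullet> (M *v y) = (M *v x) \<bullet> y"
  using inner_matrix_vector_transpose[of x M y] assms by simp

lemma GDERIV_normsq:
  fixes M :: "real^'n^'n"
  assumes "transpose M = M"
  shows "GDERIV (normsq M) x :> 2 *\<^sub>R (M *v x)"
  unfolding gderiv_def normsq_def[abs_def]
proof (rule has_derivative_eq_rhs)
  have "bounded_linear ((*v) M)" by (rule matrix_vector_mul_bounded_linear)
  then have "((*v) M has_derivative (*v) M) (at x)"
    by (rule bounded_linear_imp_has_derivative)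
  then show "((\<lambda>x. x \<bullet> (M *v x)) has_derivative (\<lambda>h. x \<bullet> (M *v h) + h \<bullet> (M *v x))) (at x)"
    by (rule has_derivative_inner[OF has_derivative_ident])
  show "(\<lambda>h. x \<bullet> (M *v h) + h \<bullet> (M *v x)) = (\<lambda>h. h \<bullet> 2 *\<^sub>R (M *v x))"
    by (simp add: fun_eq_iff symmetric_inner[OF assms, of x] inner_commute)
qed

text \<open>Eigenvectors for distinct eigenvalues are orthogonal, and orthogonal sets are finite
  here. This gives \<open>Min\<close> and \<open>Max\<close> in the extreme eigenvalues their
  meaning.\<close>

lemma finite_eigenvalues:
  fixes M :: "real^'n^'n"
  assumes "transpose M = M"
  shows "finite (eigenvalues M)"
proof -
  obtain e where e: "\<And>k. k \<in> eigenvalues M \<Longrightarrow> e k \<noteq> 0 \<and> M *v e k = k *\<^sub>R e k"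
    using bchoice[of "eigenvalues M" "\<lambda>k x. x \<noteq> 0 \<and> M *v x = k *\<^sub>R x"]
    unfolding eigenvalues_def by auto
  have orth: "e j \<bullet> e k = 0" if "j \<in> eigenvalues M" "k \<in> eigenvalues M" "j \<noteq> k" for j k
    using symmetric_inner[OF assms, of "e j" "e k"] e that by simp
  have "inj_on e (eigenvalues M)"
    using e orth by (intro inj_onI) force
  moreover have "finite (e ` eigenvalues M)"
  proof (rule pairwise_orthogonal_imp_finite)
    show "pairwise orthogonal (e ` eigenvalues M)"
      by (auto simp: pairwise_def orthogonal_def intro: orth)
  qed
  ultimately show ?thesis using finite_imageD by blast
qed

text \<open>The maximiser of the quadratic form on the unit sphere is an eigenvector.\<close>
lemma rayleigh_max:
  fixes M :: "real^'n^'n"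
  assumes sym: "transpose M = M"
  obtains k where "k \<in> eigenvalues M" and "\<And>x. x \<bullet> (M *v x) \<le> k * (norm x)\<^sup>2"
proof -
  have "continuous_on (sphere 0 1) (\<lambda>x. x \<bullet> (M *v x))"
    by (intro continuous_intros)
  then obtain x0 where x0: "norm x0 = 1"
    and max: "\<And>y. norm y = 1 \<Longrightarrow> y \<bullet> (M *v y) \<le> x0 \<bullet> (M *v x0)"
    using continuous_attains_sup[of "sphere (0::real^'n) 1" "\<lambda>x. x \<bullet> (M *v x)"] by auto
  define k where "k = x0 \<bullet> (M *v x0)"
  have le: "x \<bullet> (M *v x) \<le> k * (norm x)\<^sup>2" for x
  proof (cases "x = 0")
    case False
    define u where "u = x /\<^sub>R norm x"
    have "norm u = 1" and x: "x = norm x *\<^sub>R u" using False by (simp_all add: u_def)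
    have "x \<bullet> (M *v x) = (norm x)\<^sup>2 * (u \<bullet> (M *v u))"
      by (subst (1 2) x) (simp add: matrix_vector_mult_scaleR power2_eq_square del: norm_scaleR)
    also have "\<dots> \<le> (norm x)\<^sup>2 * k"
      unfolding k_def using \<open>norm u = 1\<close> by (intro mult_left_mono max) auto
    finally show ?thesis by (simp add: mult.commute)
  qed simp
  \<comment> \<open>By \<open>le\<close> the form of \<open>N\<close> is nonnegative, and it
    vanishes at \<open>x0\<close>. So \<open>x0\<close> minimises it, and the vanishing gradient is
    the eigenvector equation.\<close>
  define N where "N = k *\<^sub>R mat 1 - M"
  have N: "N *v x = k *\<^sub>R x - M *v x" for x
    by (simp add: N_def matrix_vector_mult_diff_rdistrib flip: scaleR_matrix_vector_assoc)
  have "transpose N = N"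
    using sym by (simp add: N_def transpose_def mat_def vec_eq_iff)
  then have "GDERIV (normsq N) x0 :> 2 *\<^sub>R (N *v x0)" by (rule GDERIV_normsq)
  then have "2 *\<^sub>R (N *v x0) = 0"
  proof (rule gradient_zero_at_minimum)
    fix y
    have form: "normsq N x = k * (norm x)\<^sup>2 - x \<bullet> (M *v x)" for x
      by (simp add: normsq_def N inner_diff_right power2_norm_eq_inner)
    show "normsq N x0 \<le> normsq N y"
      using le[of y] x0 by (simp add: form k_def)
  qed
  then have "M *v x0 = k *\<^sub>R x0" by (simp add: N)
  then have "k \<in> eigenvalues M"
    using x0 unfolding eigenvalues_def by (auto intro!: exI[of _ x0])
  with le that show thesis by blast
qed

lemma quadratic_form_le_max_eigenvalue:
  fixes M :: "real^'n^'n"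
  assumes "transpose M = M"
  shows "x \<bullet> (M *v x) \<le> max_eigenvalue M * (norm x)\<^sup>2"
proof -
  obtain k where k: "k \<in> eigenvalues M" "\<And>x. x \<bullet> (M *v x) \<le> k * (norm x)\<^sup>2"
    using rayleigh_max[OF assms] by blast
  have "k \<le> max_eigenvalue M"
    unfolding max_eigenvalue_def using k(1) finite_eigenvalues[OF assms] by simp
  then show ?thesis
    using k(2)[of x] by (smt (verit) mult_right_mono zero_le_power2)
qed

text \<open>Apply \<open>rayleigh_max\<close> to \<open>- M\<close>, whose eigenvalues are the
  negatives of those of \<open>M\<close>.\<close>

lemma min_eigenvalue_le_quadratic_form:
  fixes M :: "real^'n^'n"
  assumes "transpose M = M"
  shows "min_eigenvalue M * (norm x)\<^sup>2 \<le> x \<bullet> (M *v x)"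
proof -
  have neg: "(- M) *v y = - (M *v y)" for y
    using matrix_vector_mult_diff_rdistrib[of 0 M y] by simp
  have "transpose (- M) = - M" using assms by (simp add: transpose_def vec_eq_iff)
  then obtain k where k: "k \<in> eigenvalues (- M)" "\<And>x. x \<bullet> ((- M) *v x) \<le> k * (norm x)\<^sup>2"
    using rayleigh_max by blast
  have "- k \<in> eigenvalues M"
    using k(1) unfolding eigenvalues_def neg by (force simp: minus_equation_iff[of "M *v _"])
  then have "min_eigenvalue M \<le> - k"
    unfolding min_eigenvalue_def using finite_eigenvalues[OF assms] by simp
  then show ?thesis
    using k(2)[of x] neg by (smt (verit) inner_minus_right mult_minus_left mult_right_mono zero_le_power2)
qed

text \<open>The quadratic form of \<open>transpose M ** M\<close> is the square of
  \<open>norm (M *v x)\<close>, so its Rayleigh bound is the operator norm bound.\<close>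

lemma norm_le_max_singular_value:
  fixes M :: "real^'m^'n"
  shows "0 \<le> max_singular_value M" and "norm (M *v x) \<le> max_singular_value M * norm x"
proof -
  let ?N = "transpose M ** M"
  have sym: "transpose ?N = ?N" by (simp add: matrix_transpose_mul)
  have form: "y \<bullet> (?N *v y) = (norm (M *v y))\<^sup>2" for y
    using inner_matrix_vector_transpose[of "M *v y" M y]
    by (simp add: power2_norm_eq_inner inner_commute flip: matrix_vector_mul_assoc)
  obtain k where k: "k \<in> eigenvalues ?N" "\<And>x. x \<bullet> (?N *v x) \<le> k * (norm x)\<^sup>2"
    using rayleigh_max[OF sym] by blast
  \<comment> \<open>An arbitrary unit vector shows that \<open>k\<close> is nonnegative.\<close>
  have "0 \<le> k * (norm (axis undefined 1 :: real^'m))\<^sup>2"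
    using k(2) form by (metis order.trans zero_le_power2)
  then have k0: "0 \<le> k" by simp
  have kle: "sqrt k \<le> max_singular_value M"
    unfolding max_singular_value_def singular_values_def
    using k(1) finite_eigenvalues[OF sym] by simp
  with k0 show "0 \<le> max_singular_value M"
    by (meson order.trans real_sqrt_ge_zero)
  have "norm (M *v x) \<le> sqrt (k * (norm x)\<^sup>2)"
    using k(2)[of x] form by (intro real_le_rsqrt) simp
  also have "\<dots> = sqrt k * norm x" by (simp add: real_sqrt_mult)
  also have "\<dots> \<le> max_singular_value M * norm x" using kle by (rule mult_right_mono) simp
  finally show "norm (M *v x) \<le> max_singular_value M * norm x" .
qed

section \<open>Derivatives of the terms in the two objectives\<close>

lemma GDERIV_cmult:
  assumes "GDERIV f x :> p"
  shows "GDERIV (\<lambda>x. r * f x) x :> r *\<^sub>R p"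
  using has_derivative_mult_right[OF assms[unfolded gderiv_def], of r]
  by (simp add: gderiv_def)

lemma GDERIV_inner_const: "GDERIV (\<lambda>x. p \<bullet> (x - c)) x :> p"
  unfolding gderiv_def
  by (rule has_derivative_eq_rhs[OF has_derivative_inner_right[OF has_derivative_diff]])
    (auto intro: has_derivative_ident has_derivative_const simp: inner_commute)

lemma has_derivative_matrix_vector_mult:
  fixes M :: "real^'n^'m"
  shows "((\<lambda>x. M *v x) has_derivative (\<lambda>x. M *v x)) F"
  by (rule bounded_linear_imp_has_derivative) (rule matrix_vector_mul_bounded_linear)

lemma GDERIV_inner_matrix:
  fixes M :: "real^'n^'m"
  shows "GDERIV (\<lambda>x. p \<bullet> (M *v x)) x :> transpose M *v p"
  unfolding gderiv_def
  by (rule has_derivative_eq_rhs[OF has_derivative_inner_right[OF has_derivative_matrix_vector_mult]])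
    (simp add: inner_matrix_vector_transpose inner_commute)

lemma GDERIV_norm_matrix:
  fixes M :: "real^'n^'m"
  shows "GDERIV (\<lambda>x. (norm (M *v x - k))\<^sup>2) x :> 2 *\<^sub>R (transpose M *v (M *v x - k))"
proof -
  have d: "((\<lambda>x. M *v x - k) has_derivative (\<lambda>h. M *v h)) (at x)"
    using has_derivative_diff[OF has_derivative_matrix_vector_mult has_derivative_const] by simp
  show ?thesis
    unfolding gderiv_def power2_norm_eq_inner
    by (rule has_derivative_eq_rhs[OF has_derivative_inner[OF d d]])
      (simp only: fun_eq_iff inner_matrix_vector_transpose[of "M *v x - k" M]
        inner_commute[of "M *v _"] inner_scaleR_right inner_commute[of _ "transpose M *v _"], simp)
qed

lemma GDERIV_normsq_diff:
  fixes M :: "real^'n^'n"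
  assumes "transpose M = M"
  shows "GDERIV (\<lambda>x. normsq M (x - c)) x :> 2 *\<^sub>R (M *v (x - c))"
proof -
  have "((\<lambda>x. x - c) has_derivative (\<lambda>h. h)) (at x)"
    using has_derivative_diff[OF has_derivative_ident has_derivative_const] by simp
  from has_derivative_compose[OF this, of "normsq M"] show ?thesis
    using GDERIV_normsq[OF assms, of "x - c"] by (simp add: gderiv_def)
qed

section \<open>Seminorm estimates\<close>

text \<open>This is M^2 \<le> k M for the largest eigenvalue k: expand the nonnegative form at k x -
  M x and bound its term in M x by the Rayleigh inequality.\<close>

lemma psd_norm_le:
  fixes M :: "real^'n^'n"
  assumes psd: "sym_psd M" and pos: "max_eigenvalue M > 0"
  shows "(norm (M *v x))\<^sup>2 \<le> max_eigenvalue M * normsq M x"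
proof -
  let ?k = "max_eigenvalue M"
  have sym: "transpose M = M" using psd by (simp add: sym_psd_def)
  define y where "y = M *v x"
  have "0 \<le> normsq M (?k *\<^sub>R x - y)"
    using psd by (simp add: normsq_def sym_psd_def)
  also have "\<dots> = ?k\<^sup>2 * normsq M x - 2 * ?k * (norm y)\<^sup>2 + y \<bullet> (M *v y)"
    using symmetric_inner[OF sym, of x y]
    by (simp add: normsq_def y_def matrix_vector_mult_diff_distrib matrix_vector_mult_scaleR
        inner_diff_left inner_diff_right power2_norm_eq_inner power2_eq_square[of ?k] inner_commute
        algebra_simps)
  also have "\<dots> \<le> ?k\<^sup>2 * normsq M x - 2 * ?k * (norm y)\<^sup>2 + ?k * (norm y)\<^sup>2"
    using quadratic_form_le_max_eigenvalue[OF sym, of y] by simp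
  finally have "?k * (norm y)\<^sup>2 \<le> ?k * (?k * normsq M x)"
    by (simp add: power2_eq_square[of ?k])
  with pos show ?thesis by (simp add: y_def)
qed

lemma normsq_diff:
  fixes M :: "real^'n^'n"
  assumes "transpose M = M"
  shows "normsq M (x - y) = normsq M x - 2 * (x \<bullet> (M *v y)) + normsq M y"
  using symmetric_inner[OF assms, of x y]
  by (simp add: normsq_def matrix_vector_mult_diff_distrib inner_diff_left inner_diff_right
      inner_commute)

lemma normsq_add:
  fixes M :: "real^'n^'n"
  assumes "transpose M = M"
  shows "normsq M (x + y) = normsq M x + 2 * (x \<bullet> (M *v y)) + normsq M y"
  using symmetric_inner[OF assms, of x y]
  by (simp add: normsq_def matrix_vector_right_distrib inner_add_left inner_add_right
      inner_commute)

lemma normsq_le_max_singular_value: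
  fixes M :: "real^'n^'n"
  shows "normsq M x \<le> max_singular_value M * (norm x)\<^sup>2"
proof -
  have "normsq M x \<le> norm x * norm (M *v x)"
    unfolding normsq_def by (rule norm_cauchy_schwarz)
  also have "\<dots> \<le> norm x * (max_singular_value M * norm x)"
    by (intro mult_left_mono norm_le_max_singular_value) simp
  finally show ?thesis by (simp add: power2_eq_square mult_ac)
qed

text \<open>With \<open>H = A\<^sup>T Ht A\<close> and \<open>f = A h\<close> one has \<open>A\<^sup>T Ht f = H h\<close> and \<open>normsq Ht f = normsq H h\<close>.\<close>
lemma normsq_le_norm_transpose:
  fixes A H Ht :: "real^'n^'n"
  assumes inv: "invertible A" and H: "H = transpose A ** Ht ** A"
    and sym: "transpose H = H" and "\<gamma> > 0" and min: "min_eigenvalue H \<ge> 1 / \<gamma>"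
  shows "normsq Ht f \<le> \<gamma> * (norm (transpose A *v (Ht *v f)))\<^sup>2"
proof -
  obtain A' where "A ** A' = mat 1" using inv by (auto simp: invertible_def)
  then obtain h where f: "f = A *v h"
    by (metis matrix_vector_mul_assoc matrix_vector_mul_lid)
  have Hh: "H *v h = transpose A *v (Ht *v f)"
    by (simp add: H f matrix_vector_mul_assoc matrix_mul_assoc)
  have form: "h \<bullet> (H *v h) = normsq Ht f"
    unfolding Hh normsq_def
    using inner_matrix_vector_transpose[of h "transpose A" "Ht *v f"] by (simp add: f)
  \<comment> \<open>Cauchy-Schwarz turns the lower bound on the form of \<open>H\<close> into
    \<open>norm h \<le> \<gamma> * norm (H *v h)\<close>. A second use bounds the form by \<gamma>
    times the squared norm of \<open>H *v h\<close>.\<close>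
  have "(1 / \<gamma>) * (norm h)\<^sup>2 \<le> h \<bullet> (H *v h)"
    using min_eigenvalue_le_quadratic_form[OF sym, of h] mult_right_mono[OF min, of "(norm h)\<^sup>2"]
    by simp
  also have "\<dots> \<le> norm h * norm (H *v h)" by (rule norm_cauchy_schwarz)
  finally have "norm h * norm h \<le> norm h * (\<gamma> * norm (H *v h))"
    using \<open>\<gamma> > 0\<close> by (simp add: field_simps power2_eq_square)
  then have "norm h \<le> \<gamma> * norm (H *v h)"
    using \<open>\<gamma> > 0\<close> by (cases "h = 0") auto
  then have "norm h * norm (H *v h) \<le> \<gamma> * norm (H *v h) * norm (H *v h)"
    by (rule mult_right_mono) simp
  with norm_cauchy_schwarz[of h "H *v h"] have "h \<bullet> (H *v h) \<le> \<gamma> * (norm (H *v h))\<^sup>2"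
    by (simp add: power2_eq_square mult_ac)
  then show ?thesis unfolding form unfolding Hh .
qed

section \<open>Optimality conditions of the two subproblems\<close>

text \<open>For \<open>b\<close> equal to B v^t, the vector multiplied by \<open>transpose A\<close>
  is the updated dual variable, so stationarity is expressed through \<alpha>^t.\<close>

lemma quad_model_minimizer:
  fixes A H :: "real^'n^'n"
  assumes sym: "transpose H = H"
    and min: "is_arg_min (\<lambda>x. quad_model \<phi> H w' x + a \<bullet> (A *v x)
            + \<rho> / 2 * (norm (A *v x - b - c))\<^sup>2) (\<lambda>_. True) w"
  shows "gradient \<phi> w' + H *v (w - w') + transpose A *v (a + \<rho> *\<^sub>R (A *v w - b - c)) = 0"
proof (rule gradient_zero_at_minimum)
  let ?q = "\<lambda>x. quad_model \<phi> H w' x + a \<bullet> (A *v x) + \<rho> / 2 * (norm (A *v x - b - c))\<^sup>2"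
  show "?q w \<le> ?q y" for y
    using min unfolding is_arg_min_def by (simp add: not_less)
  have "GDERIV ?q w :> (0 + gradient \<phi> w' + (1 / 2) *\<^sub>R 2 *\<^sub>R (H *v (w - w')))
      + transpose A *v a + (\<rho> / 2) *\<^sub>R 2 *\<^sub>R (transpose A *v (A *v w - (b + c)))"
    unfolding quad_model_def diff_diff_eq normsq_def[symmetric]
    by (intro GDERIV_add GDERIV_cmult GDERIV_const GDERIV_inner_const GDERIV_inner_matrix
        GDERIV_norm_matrix GDERIV_normsq_diff sym)
  then show "GDERIV ?q w :> gradient \<phi> w' + H *v (w - w') + transpose A *v (a + \<rho> *\<^sub>R (A *v w - b - c))"
    by (simp add: matrix_vector_right_distrib matrix_vector_mult_scaleR diff_diff_eq add.assoc)
qed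

text \<open>Fermat's rule with \<open>g\<close> as nonsmooth part. Here \<open>k\<close> is A
  w^(t-1), so the multiplier contains the old primal iterate and differs from \<alpha>^t by \<rho> A
  (w^t - w^(t-1)).\<close>

lemma proximal_minimizer:
  fixes g :: "real^'m \<Rightarrow> ereal" and B :: "real^'m^'n" and G :: "real^'m^'m"
  assumes conv: "convex_ereal g" and proper: "proper_fun g" and sym: "transpose G = G"
    and min: "is_arg_min (\<lambda>x. g x + ereal (- (a \<bullet> (B *v x)) + \<rho> / 2 * (norm (k - B *v x - c))\<^sup>2
                   + \<rho> / 2 * normsq G (x - v'))) (\<lambda>_. True) v"
  shows "subgradient g v (transpose B *v (a + \<rho> *\<^sub>R (k - B *v v - c)) - \<rho> *\<^sub>R (G *v (v - v')))"
proof -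
  define q where "q x = - (a \<bullet> (B *v x)) + \<rho> / 2 * (norm (k - B *v x - c))\<^sup>2
                   + \<rho> / 2 * normsq G (x - v')" for x
  have le: "g v + ereal (q v) \<le> g y + ereal (q y)" for y
    using min unfolding is_arg_min_def q_def by (simp add: not_less)
  \<comment> \<open>A competitor with finite value forces the minimum to be finite.\<close>
  obtain y where "g y \<noteq> \<infinity>" using proper by (auto simp: proper_fun_def)
  then have "g v \<noteq> \<infinity>" using le[of y] by auto
  then have fin: "\<bar>g v\<bar> \<noteq> \<infinity>" using proper by (auto simp: proper_fun_def)
  have "q = (\<lambda>x. (- a) \<bullet> (B *v x) + \<rho> / 2 * (norm (B *v x - (k - c)))\<^sup>2 + \<rho> / 2 * normsq G (x - v'))"
  proof -
    have "norm (k - B *v x - c) = norm (B *v x - (k - c))" for x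
      using norm_minus_commute[of "k - c" "B *v x"] by (simp add: algebra_simps)
    then show ?thesis by (simp add: q_def fun_eq_iff)
  qed
  moreover have "GDERIV \<dots> v :> transpose B *v (- a)
      + (\<rho> / 2) *\<^sub>R 2 *\<^sub>R (transpose B *v (B *v v - (k - c))) + (\<rho> / 2) *\<^sub>R 2 *\<^sub>R (G *v (v - v'))"
    by (intro GDERIV_add GDERIV_cmult GDERIV_inner_matrix GDERIV_norm_matrix GDERIV_normsq_diff sym)
  moreover have "\<dots> = - (transpose B *v (a + \<rho> *\<^sub>R (k - B *v v - c)) - \<rho> *\<^sub>R (G *v (v - v')))"
    by (simp add: matrix_vector_right_distrib matrix_vector_mult_diff_distrib
        matrix_vector_mult_scaleR algebra_simps vec.neg)
  ultimately have "GDERIV q v :> - (transpose B *v (a + \<rho> *\<^sub>R (k - B *v v - c)) - \<rho> *\<^sub>R (G *v (v - v')))"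
    by simp
  from subgradient_of_minimizer[OF conv proper fin this le] show ?thesis by simp
qed

section \<open>Young inequalities and decrease of the Lyapunov function in one step\<close>

text \<open>The difference of the two sides is
  \<open>(norm ((\<rho> - m) *\<^sub>R x - \<rho> *\<^sub>R b))\<^sup>2 / (\<rho> - m)\<close>.\<close>
lemma weighted_young:
  fixes x b :: "'a::real_inner"
  assumes "m < \<rho>"
  shows "m * (norm x)\<^sup>2 \<le> \<rho> * (norm (b - x))\<^sup>2 + m * \<rho> / (\<rho> - m) * (norm b)\<^sup>2"
proof -
  have sq: "(norm ((\<rho> - m) *\<^sub>R x - \<rho> *\<^sub>R b))\<^sup>2
      = (\<rho> - m) * ((\<rho> - m) * (norm x)\<^sup>2) - 2 * \<rho> * ((\<rho> - m) * (x \<bullet> b)) + \<rho>\<^sup>2 * (norm b)\<^sup>2"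
    unfolding power2_norm_eq_inner power2_eq_square[of \<rho>]
    by (simp add: inner_diff_left inner_diff_right inner_commute[of b x] algebra_simps)
  have "0 \<le> (norm ((\<rho> - m) *\<^sub>R x - \<rho> *\<^sub>R b))\<^sup>2 / (\<rho> - m)" using assms by simp
  also have "\<dots> = (\<rho> - m) * (norm x)\<^sup>2 - 2 * \<rho> * (x \<bullet> b) + \<rho>\<^sup>2 / (\<rho> - m) * (norm b)\<^sup>2"
    unfolding sq using assms by (simp add: add_divide_distrib diff_divide_distrib)
  also have "\<rho>\<^sup>2 / (\<rho> - m) = \<rho> + m * \<rho> / (\<rho> - m)"
    using assms by (simp add: power2_eq_square field_simps)
  finally show ?thesis
    by (simp add: power2_norm_eq_inner inner_diff_left inner_diff_right inner_commute algebra_simps)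
qed

text \<open>Use \<open>weighted_young\<close> with
  \<open>m = \<theta> * (\<sigma> + \<rho>) / (1 + \<theta>)\<close>. The bound on
  \<open>\<theta> * \<sigma>\<close> keeps \<open>\<rho> - m\<close> above
  \<open>\<rho> * (1 - s) / (1 + \<theta>)\<close>, which is where the factor
  \<open>1 / (1 - s)\<close> comes from.\<close>

lemma contraction_young:
  fixes x b :: "'a::real_inner"
  assumes "\<rho> > 0" "\<theta> > 0" "0 \<le> s" "s < 1" "0 \<le> \<sigma>" "\<theta> * \<sigma> \<le> s * \<rho>"
  shows "\<theta> / (1 + \<theta>) * ((\<sigma> + \<rho>) * (norm x)\<^sup>2)
    \<le> \<rho> * (norm (b - x))\<^sup>2 + \<theta> * (\<sigma> + \<rho>) / (1 - s) * (norm b)\<^sup>2"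
proof -
  define m where "m = \<theta> * (\<sigma> + \<rho>) / (1 + \<theta>)"
  have "m \<ge> 0" using assms by (simp add: m_def)
  have gap: "\<rho> * (1 - s) / (1 + \<theta>) \<le> \<rho> - m"
  proof -
    have "m * (1 + \<theta>) = \<theta> * (\<sigma> + \<rho>)" using \<open>\<theta> > 0\<close> by (simp add: m_def)
    also have "\<dots> \<le> s * \<rho> + \<theta> * \<rho>" using assms by (simp add: distrib_left)
    finally have "m * (1 + \<theta>) \<le> s * \<rho> + \<theta> * \<rho>" .
    then have "\<rho> * (1 - s) \<le> (\<rho> - m) * (1 + \<theta>)" by (simp add: algebra_simps)
    then show ?thesis using \<open>\<theta> > 0\<close> by (simp add: divide_le_eq)
  qed
  have pos: "0 < \<rho> * (1 - s) / (1 + \<theta>)" using assms by simp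
  have "m * (norm x)\<^sup>2 \<le> \<rho> * (norm (b - x))\<^sup>2 + m * \<rho> / (\<rho> - m) * (norm b)\<^sup>2"
    using gap pos by (intro weighted_young) linarith
  also have "m * \<rho> / (\<rho> - m) \<le> m * \<rho> / (\<rho> * (1 - s) / (1 + \<theta>))"
  proof (rule divide_left_mono)
    show "0 \<le> m * \<rho>" using \<open>m \<ge> 0\<close> \<open>\<rho> > 0\<close> by simp
    show "0 < (\<rho> - m) * (\<rho> * (1 - s) / (1 + \<theta>))" using gap pos by (intro mult_pos_pos) linarith+
  qed (rule gap)
  also have "\<dots> = \<theta> * (\<sigma> + \<rho>) / (1 - s)"
    using assms by (simp add: m_def)
  finally show ?thesis by (simp add: m_def mult_right_mono)
qed

text \<open>Primes mark the old iterate: \<open>x\<close> is the residual A w^t - B v - c,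
  \<open>a\<close> the dual error, \<open>y\<close> the error v^t - v, and \<open>b\<close> is B y.
  Polarisation turns all inner products into differences of squares; what remains is covered by the
  assumptions on \<open>Q\<close>, \<open>P\<close>, \<open>K\<close> and \<open>l\<close>.\<close>

lemma lyapunov_decrease:
  fixes x x' a a' b :: "real^'n" and y y' :: "real^'m"
    and Ht :: "real^'n^'n" and G :: "real^'m^'m"
  assumes "\<rho> > 0" "\<theta> > 0" and Ht: "transpose Ht = Ht" and G: "sym_psd G"
    and a: "a = a' + \<rho> *\<^sub>R (x - b)"
    and Q: "P + 2 * (a \<bullet> (x - x')) + normsq Ht (x - x') \<le> 2 * Q"
    and P: "\<theta> / \<rho> * (norm a)\<^sup>2 \<le> P"
    and K: "\<theta> / (1 + \<theta>) * (normsq Ht x' + \<rho> * (norm x')\<^sup>2) \<le> \<rho> * (norm (b - x'))\<^sup>2 + K"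
    and l: "K + \<theta> * \<rho> * normsq G y \<le> l * (norm y)\<^sup>2"
  defines "\<delta> \<equiv> 1 / 2 * (normsq Ht x + \<rho> * (norm x)\<^sup>2 + \<rho> * (1 + \<theta>) * normsq G y
      + (1 + \<theta>) / \<rho> * (norm a)\<^sup>2)"
    and "\<delta>' \<equiv> 1 / 2 * (normsq Ht x' + \<rho> * (norm x')\<^sup>2 + \<rho> * (1 + \<theta>) * normsq G y'
      + (1 + \<theta>) / \<rho> * (norm a')\<^sup>2)"
  shows "- Q - (a + Ht *v (x - x')) \<bullet> x' + a \<bullet> b - \<rho> * ((x - x') \<bullet> b)
      - \<rho> * (y \<bullet> (G *v (y - y'))) - l / 2 * (norm y)\<^sup>2 \<le> \<delta>' / (1 + \<theta>) - \<delta>"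
proof -
  have symG: "transpose G = G" using G by (simp add: sym_psd_def)
  have 1: "2 * ((Ht *v (x - x')) \<bullet> x') = normsq Ht x - normsq Ht x' - normsq Ht (x - x')"
    using normsq_add[OF Ht, of "x'" "x - x'"] by (simp add: inner_commute)
  have 2: "2 * (y \<bullet> (G *v (y - y'))) = normsq G y - normsq G y' + normsq G (y - y')"
    using normsq_diff[OF symG, of y y']
    by (simp add: normsq_def matrix_vector_mult_diff_distrib inner_diff_right)
  have G0: "0 \<le> \<rho> * normsq G (y - y')" using G \<open>\<rho> > 0\<close> by (simp add: normsq_def sym_psd_def)
  have a': "a' = a - \<rho> *\<^sub>R (x - b)" by (simp add: a)
  have "((norm a)\<^sup>2 - (norm a')\<^sup>2) / \<rho> = 2 * (a \<bullet> (x - b)) - \<rho> * (norm (x - b))\<^sup>2"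
  proof -
    have "(norm a)\<^sup>2 - (norm a')\<^sup>2 = \<rho> * (2 * (a \<bullet> (x - b)) - \<rho> * (norm (x - b))\<^sup>2)"
    proof -
      have "(norm (a - \<rho> *\<^sub>R u))\<^sup>2 = (norm a)\<^sup>2 - 2 * \<rho> * (a \<bullet> u) + \<rho> * (\<rho> * (norm u)\<^sup>2)" for u
        by (simp add: power2_norm_eq_inner inner_diff_left inner_diff_right inner_commute[of u a]
            right_diff_distrib)
      then show ?thesis unfolding a' by (simp add: right_diff_distrib)
    qed
    then show ?thesis using \<open>\<rho> > 0\<close> by simp
  qed
  \<comment> \<open>The dual update and the cross term with \<open>x - x'\<close> combine into a
    completed square; its negative part in \<open>b - x'\<close> is what pays for
    \<open>K\<close>.\<close>
  then have 3: "2 * (a \<bullet> b) - 2 * (a \<bullet> x') - 2 * \<rho> * ((x - x') \<bullet> b)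
    = 2 * (a \<bullet> (x - x')) - ((norm a)\<^sup>2 - (norm a')\<^sup>2) / \<rho> - \<rho> * (norm x)\<^sup>2 + \<rho> * (norm x')\<^sup>2
      - \<rho> * (norm (b - x'))\<^sup>2"
    by (simp add: power2_norm_eq_inner inner_diff_left inner_diff_right inner_commute algebra_simps)
  define X where "X = normsq Ht x' + \<rho> * (norm x')\<^sup>2"
  \<comment> \<open>In \<open>\<delta>'\<close> only \<open>X\<close> lacks the factor
    \<open>1 + \<theta>\<close>, so division by it leaves the deficit
    \<open>\<theta> / (1 + \<theta>) * X\<close>, covered by \<open>K\<close>.\<close>
  have 4: "2 * (\<delta>' / (1 + \<theta>)) = X - \<theta> / (1 + \<theta>) * X + \<rho> * normsq G y' + (norm a')\<^sup>2 / \<rho>"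
  proof -
    define Z where "Z = X / (1 + \<theta>) + \<rho> * normsq G y' + (norm a')\<^sup>2 / \<rho>"
    have "2 * \<delta>' = (1 + \<theta>) * Z"
      using \<open>\<theta> > 0\<close> unfolding \<delta>'_def X_def[symmetric] Z_def
      by (simp add: distrib_left) (simp add: algebra_simps)
    then have "2 * (\<delta>' / (1 + \<theta>)) = Z" using \<open>\<theta> > 0\<close> by (simp add: field_simps)
    moreover have "X / (1 + \<theta>) = X - \<theta> / (1 + \<theta>) * X" using \<open>\<theta> > 0\<close> by (simp add: field_simps)
    ultimately show ?thesis by (simp add: Z_def)
  qed
  \<comment> \<open>The surplus \<theta> terms in \<open>y\<close> and \<open>a\<close> are isolated
    here; the first is paid by strong convexity through \<open>l\<close>, the second by
    \<open>P\<close>.\<close>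
  have 5: "2 * \<delta> = normsq Ht x + \<rho> * (norm x)\<^sup>2 + \<rho> * normsq G y + \<theta> * \<rho> * normsq G y
      + (norm a)\<^sup>2 / \<rho> + \<theta> / \<rho> * (norm a)\<^sup>2"
    unfolding \<delta>_def by (simp add: algebra_simps add_divide_distrib)
  have 6: "2 * (\<rho> * (y \<bullet> (G *v (y - y')))) = \<rho> * normsq G y - \<rho> * normsq G y' + \<rho> * normsq G (y - y')"
    using arg_cong[OF 2, of "\<lambda>z. \<rho> * z"] by (simp add: algebra_simps)
  have "2 * (- Q - (a + Ht *v (x - x')) \<bullet> x' + a \<bullet> b - \<rho> * ((x - x') \<bullet> b)
      - \<rho> * (y \<bullet> (G *v (y - y'))) - l / 2 * (norm y)\<^sup>2) \<le> 2 * (\<delta>' / (1 + \<theta>)) - 2 * \<delta>"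
    using 1 3 6 G0 Q P K[folded X_def] l unfolding 4 5 X_def
    by (simp add: inner_add_left diff_divide_distrib)
  then show ?thesis by simp
qed

text \<open>A zero denominator makes the bound on \<theta> vacuous, and then the claim is just
  \<open>0 \<le> p\<close>.\<close>

lemma le_frac_inf:
  assumes "ereal \<theta> \<le> frac_inf p q" "0 \<le> q" "0 \<le> p"
  shows "\<theta> * q \<le> p"
  using assms by (cases "q = 0") (auto simp: frac_inf_def field_simps)

text \<open>The weight of step \<open>t\<close> divided by \<open>1 + \<theta>\<close> is the weight
  of step \<open>t - 1\<close>, so the weighted bounds telescope. The gaps are extended reals
  because they equal -\<infinity> where \<open>g v\<close> is infinite.\<close>

lemma weighted_sum_le_telescope:
  fixes \<theta> :: real and \<delta> :: "nat \<Rightarrow> real" and f :: "nat \<Rightarrow> ereal"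
  assumes "\<theta> > 0" and f: "\<And>t. t \<ge> 1 \<Longrightarrow> f t \<le> ereal (\<delta> (t - 1) / (1 + \<theta>) - \<delta> t)"
  shows "(\<Sum>t=1..T. ereal ((1 + \<theta>) powi (int t - int T)) * f t)
    \<le> ereal ((1 + \<theta>) powi (- int T) * \<delta> 0 - \<delta> T)"
proof -
  define F where "F t = (1 + \<theta>) powi (int t - int T) * \<delta> t" for t
  have "(\<Sum>t=1..T. ereal ((1 + \<theta>) powi (int t - int T)) * f t) \<le> (\<Sum>t=1..T. ereal (F (t - 1) - F t))"
  proof (rule sum_mono)
    fix t assume "t \<in> {1..T}"
    then have t: "t \<ge> 1" by simp
    define p where "p = (1 + \<theta>) powi (int t - int T)"
    have "p > 0" using \<open>\<theta> > 0\<close> by (simp add: p_def)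
    have "(1 + \<theta>) powi (int (t - 1) - int T) = (1 + \<theta>) powi ((int t - int T) - 1)"
      using t by (simp add: of_nat_diff algebra_simps)
    also have "\<dots> = p / (1 + \<theta>)"
      unfolding p_def using \<open>\<theta> > 0\<close> by (subst power_int_diff) auto
    finally have "F (t - 1) - F t = p * (\<delta> (t - 1) / (1 + \<theta>) - \<delta> t)"
      unfolding F_def p_def by (simp add: right_diff_distrib)
    moreover have "ereal p * f t \<le> ereal p * ereal (\<delta> (t - 1) / (1 + \<theta>) - \<delta> t)"
      using \<open>p > 0\<close> by (intro ereal_mult_left_mono f t) simp
    ultimately show "ereal ((1 + \<theta>) powi (int t - int T)) * f t \<le> ereal (F (t - 1) - F t)"
      by (simp add: p_def)
  qed
  also have "\<dots> = ereal (\<Sum>t=1..T. F (t - 1) - F t)" by simp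
  also have "(\<Sum>t=1..n. F (t - 1) - F t) = F 0 - F n" for n by (induction n) auto
  finally show ?thesis by (simp add: F_def)
qed

section \<open>Contraction of both gaps along a run of the algorithm\<close>

theorem theorem3p2:
  fixes \<phi> :: "real^'n \<Rightarrow> real" and g :: "real^'m \<Rightarrow> ereal"
    and A H Ht :: "real^'n^'n" and B :: "real^'m^'n" and G :: "real^'m^'m"
    and c :: "real^'n" and \<gamma> l \<rho> s \<theta> :: real
    and wt \<alpha>t \<alpha>tilde :: "nat \<Rightarrow> real^'n" and vt :: "nat \<Rightarrow> real^'m"
    and \<alpha> w :: "real^'n" and v :: "real^'m"
    and r rstar :: "nat \<Rightarrow> ereal" and \<delta> :: "nat \<Rightarrow> real" and T :: nat
  assumes "\<gamma> > 0" and "l > 0" and "\<rho> > 0"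
    and "convex_on UNIV \<phi>" and "smooth_fun (1 / \<gamma>) \<phi>"
    and "proper_fun g" and "convex_ereal g" and "strongly_convex l g"
    and "invertible A"
    and "sym_psd G" and "sym_psd H" and "sym_psd Ht"
    and "H = transpose A ** Ht ** A"
    and "min_eigenvalue H \<ge> 1 / \<gamma>"
    and "0 \<le> s" and "s < 1" and "\<theta> > 0"
    and "ereal \<theta> \<le> Min {
      frac_inf (\<rho> * (min_eigenvalue (psd_sqrt (A ** transpose A)))\<^sup>2) (min_eigenvalue H),
      frac_inf (s * \<rho>) (max_eigenvalue Ht),
      frac_inf ((1 - s) * l)
        ((\<rho> + max_eigenvalue Ht) * (max_singular_value B)\<^sup>2 + (1 - s) * \<rho> * max_singular_value G)}"
    and "pladmm \<phi> g A B c \<rho> G H wt vt \<alpha>t"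
    and "\<And>t. t \<ge> 1 \<Longrightarrow> \<alpha>tilde t = \<alpha>t t + Ht *v (A *v (wt t - wt (t - 1)))"
    and "subgradient (convex_conjugate (\<lambda>x. ereal (\<phi> x))) (- (transpose A *v \<alpha>)) w"
    and "\<And>t. t \<ge> 1 \<Longrightarrow> r t =
      ereal (\<phi> (wt (t - 1))) + g (vt t) - ereal (\<phi> w) - g v
      - ereal (\<alpha>tilde t \<bullet> (A *v w - B *v v - c))
      + ereal (\<alpha> \<bullet> (A *v wt (t - 1) - B *v vt t - c))"
    and "\<And>t. t \<ge> 1 \<Longrightarrow> rstar t =
      convex_conjugate (\<lambda>x. ereal (\<phi> x)) (- (transpose A *v \<alpha>tilde t)) + g (vt t)
      - convex_conjugate (\<lambda>x. ereal (\<phi> x)) (- (transpose A *v \<alpha>)) - g v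
      + ereal (\<alpha>tilde t \<bullet> (B *v v + c)) - ereal (\<alpha> \<bullet> (B *v vt t + c))"
    and "\<And>t. \<delta> t = 1 / 2 *
      (normsq Ht (A *v wt t - B *v v - c) + \<rho> * (norm (A *v wt t - B *v v - c))\<^sup>2
       + \<rho> * (1 + \<theta>) * normsq G (vt t - v) + (1 + \<theta>) / \<rho> * (norm (\<alpha>t t - \<alpha>))\<^sup>2)"
    and "T \<ge> 1"
  shows "(\<Sum>t=1..T. ereal ((1 + \<theta>) powi (int t - int T)) * r t)
           \<le> ereal ((1 + \<theta>) powi (- int T) * \<delta> 0 - \<delta> T) \<and>
         (\<Sum>t=1..T. ereal ((1 + \<theta>) powi (int t - int T)) * rstar t)
           \<le> ereal ((1 + \<theta>) powi (- int T) * \<delta> 0 - \<delta> T)"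
proof -
  note \<gamma> = assms(1) and l = assms(2) and \<rho> = assms(3) and conv = assms(4) and smooth = assms(5)
    and proper = assms(6) and gconv = assms(7) and gstrong = assms(8) and inv = assms(9)
    and G = assms(10) and H = assms(11) and Ht = assms(12) and HA = assms(13) and minH = assms(14)
    and s = assms(15,16) and \<theta> = assms(17) and bounds = assms(18) and run = assms(19)
    and tilde = assms(20) and sub = assms(21) and r = assms(22) and rstar = assms(23)
    and \<delta> = assms(24)
  have symG: "transpose G = G" and symH: "transpose H = H" and symHt: "transpose Ht = Ht"
    using G H Ht by (auto simp: sym_psd_def)
  have diff: "\<phi> differentiable (at x)" for x using smooth by (simp add: smooth_fun_def)
  have grad_w: "gradient \<phi> w = - (transpose A *v \<alpha>)"
    by (rule subgradient_convex_conjugate[OF conv diff sub])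
  define \<sigma> where "\<sigma> = max_eigenvalue Ht"
  have Q_le: "normsq Ht f \<le> \<gamma> * (norm (transpose A *v (Ht *v f)))\<^sup>2" for f
    by (rule normsq_le_norm_transpose[OF inv HA symH \<gamma> minH])
  have Ht_le: "normsq Ht x \<le> \<sigma> * (norm x)\<^sup>2" for x
    unfolding \<sigma>_def normsq_def by (rule quadratic_form_le_max_eigenvalue[OF symHt])
  \<comment> \<open>The eigenvalue bound makes \<open>H\<close> positive definite, and invertibility
    of \<open>A\<close> carries nonsingularity over to \<open>Ht\<close>. This allows every dual
    error to be written as \<open>Ht *v e\<close>.\<close>
  have Ht_inj: "f = 0" if "Ht *v f = 0" for f
  proof -
    obtain A' where "A ** A' = mat 1" using inv by (auto simp: invertible_def)
    then obtain h where f: "f = A *v h"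
      by (metis matrix_vector_mul_assoc matrix_vector_mul_lid)
    have "H *v h = transpose A *v (Ht *v f)"
      by (simp add: HA f matrix_vector_mul_assoc matrix_mul_assoc)
    then have "min_eigenvalue H * (norm h)\<^sup>2 \<le> 0"
      using min_eigenvalue_le_quadratic_form[OF symH, of h] that by simp
    moreover have "0 < min_eigenvalue H" using minH \<gamma> by (smt (verit) divide_pos_pos)
    ultimately have "(norm h)\<^sup>2 \<le> 0" by (simp add: mult_le_0_iff)
    then show ?thesis by (simp add: f)
  qed
  have \<sigma>_pos: "\<sigma> > 0"
  proof -
    \<comment> \<open>At any unit vector the form of \<open>Ht\<close> is positive: a zero value
      would be a minimum, so \<open>Ht\<close> would annihilate the vector.\<close>
    define x :: "real^'n" where "x = axis undefined 1"
    have "norm x = 1" by (simp add: x_def norm_axis_1)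
    then have "Ht *v x \<noteq> 0" using Ht_inj[of x] by auto
    moreover have "Ht *v x = 0" if "normsq Ht x = 0"
    proof -
      have "2 *\<^sub>R (Ht *v x) = 0"
        by (rule gradient_zero_at_minimum[OF GDERIV_normsq[OF symHt]])
          (use that Ht in \<open>simp add: normsq_def sym_psd_def\<close>)
      then show ?thesis by simp
    qed
    moreover have "0 \<le> normsq Ht x" using Ht by (simp add: normsq_def sym_psd_def)
    ultimately have "0 < normsq Ht x" by fastforce
    also have "\<dots> \<le> \<sigma>" using Ht_le[of x] \<open>norm x = 1\<close> by simp
    finally show ?thesis .
  qed
  have Ht_surj: "\<exists>e. Ht *v e = a" for a
  proof -
    have "inj ((*v) Ht)"
      by (rule injI) (metis Ht_inj eq_iff_diff_eq_0 matrix_vector_mult_diff_distrib)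
    then have "surj ((*v) Ht)"
      by (intro linear_injective_imp_surjective) auto
    then show ?thesis by (metis surj_def)
  qed
  have nonneg: "0 \<le> max_singular_value B" "0 \<le> max_singular_value G"
    by (rule norm_le_max_singular_value)+
  have \<theta>2: "\<theta> * \<sigma> \<le> s * \<rho>"
    unfolding \<sigma>_def using bounds \<sigma>_pos s \<rho> by (intro le_frac_inf) (auto simp: \<sigma>_def)
  have \<theta>3: "\<theta> * ((\<rho> + \<sigma>) * (max_singular_value B)\<^sup>2 + (1 - s) * \<rho> * max_singular_value G) \<le> (1 - s) * l"
    unfolding \<sigma>_def using bounds \<sigma>_pos s \<rho> l nonneg by (intro le_frac_inf) (auto simp: \<sigma>_def)
  have step: "r t \<le> ereal (\<delta> (t - 1) / (1 + \<theta>) - \<delta> t) \<and> rstar t \<le> ereal (\<delta> (t - 1) / (1 + \<theta>) - \<delta> t)"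
    if t: "t \<ge> 1" for t
  proof -
    \<comment> \<open>Primes denote iterate \<open>t - 1\<close>, the suffix 1 iterate
      \<open>t\<close>, and \<open>a2\<close> the corrected dual variable.\<close>
    define w' w1 a' a1 v' v1 a2 where defs: "w' = wt (t - 1)" "w1 = wt t" "a' = \<alpha>t (t - 1)"
      "a1 = \<alpha>t t" "v' = vt (t - 1)" "v1 = vt t" "a2 = \<alpha>tilde t"
    note run_t = run[unfolded pladmm_def, rule_format, OF t, folded defs]
    have a1: "a1 = a' + \<rho> *\<^sub>R (A *v w1 - B *v v1 - c)" using run_t by blast
    have a2: "a2 = a1 + Ht *v (A *v (w1 - w'))" using tilde[OF t] by (simp add: defs)
    have "gradient \<phi> w' + H *v (w1 - w') + transpose A *v a1 = 0"
      unfolding a1 using run_t by (intro quad_model_minimizer[OF symH]) blast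
    \<comment> \<open>Factoring \<open>H\<close> through \<open>A\<close> turns the preconditioning
      term into the correction contained in \<open>a2\<close>.\<close>
    then have "gradient \<phi> w' + transpose A *v a2 = 0"
      unfolding a2 HA
      by (simp only: matrix_vector_right_distrib matrix_vector_mul_assoc[symmetric] ac_simps)
    then have grad_w': "gradient \<phi> w' = - (transpose A *v a2)"
      by (simp only: eq_neg_iff_add_eq_0)
    have gsub: "subgradient g v1
      (transpose B *v (a' + \<rho> *\<^sub>R (A *v w' - B *v v1 - c)) - \<rho> *\<^sub>R (G *v (v1 - v')))"
      using run_t by (intro proximal_minimizer[OF gconv proper symG]) blast
    then obtain g1 where g1: "g v1 = ereal g1" by (auto simp: subgradient_def)
    show ?thesis
    proof (cases "g v")
      case PInf
      \<comment> \<open>Both gaps are -\<infinity> in this case, once their other terms are known to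
        be finite. The conjugates are finite because they are evaluated at gradients.\<close>
      have "\<bar>convex_conjugate (\<lambda>x. ereal (\<phi> x)) (gradient \<phi> x)\<bar> \<noteq> \<infinity>" for x
        by (simp add: convex_conjugate_gradient[OF conv diff])
      then obtain k k' where "convex_conjugate (\<lambda>x. ereal (\<phi> x)) (- (transpose A *v a2)) = ereal k"
          "convex_conjugate (\<lambda>x. ereal (\<phi> x)) (- (transpose A *v \<alpha>)) = ereal k'"
        by (metis ereal_infinity_cases grad_w grad_w' ereal_cases abs_ereal.simps(2,3))
      then show ?thesis
        using r[OF t] rstar[OF t] g1 PInf by (simp add: defs)
    next
      case MInf
      then show ?thesis using proper by (simp add: proper_fun_def)
    next
      case (real g0)
      define a x x' y y' b where vars: "a = a1 - \<alpha>" "x = A *v w1 - B *v v - c"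
        "x' = A *v w' - B *v v - c" "y = v1 - v" "y' = v' - v" "b = B *v y"
      have d: "x - x' = A *v (w1 - w')" by (simp add: vars matrix_vector_mult_diff_distrib)
      have resid: "A *v w1 - B *v v1 - c = x - b" "A *v w' - B *v v1 - c = x' - b"
        by (simp_all add: vars matrix_vector_mult_diff_distrib)
      have ax: "a = (a' - \<alpha>) + \<rho> *\<^sub>R (x - b)" by (simp add: vars(1) a1 resid)
      have tilde_diff: "a2 - \<alpha> = a + Ht *v (x - x')" by (simp add: a2 vars(1) d)
      define Q where "Q = \<gamma> / 2 * (norm (transpose A *v (a2 - \<alpha>)))\<^sup>2"
      obtain e where e: "Ht *v e = a" using Ht_surj by blast
      \<comment> \<open>By \<open>tilde_diff\<close> and the choice of \<open>e\<close>, the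
        difference \<open>a2 - \<alpha>\<close> is \<open>Ht\<close> applied to
        \<open>e + (x - x')\<close>, so \<open>Q\<close> controls a full square containing the cross
        term.\<close>
      have Q: "normsq Ht e + 2 * (a \<bullet> (x - x')) + normsq Ht (x - x') \<le> 2 * Q"
      proof -
        have "normsq Ht e + 2 * (a \<bullet> (x - x')) + normsq Ht (x - x') = normsq Ht (e + (x - x'))"
          by (simp only: normsq_add[OF symHt] symmetric_inner[OF symHt, of e "x - x'"] e)
        also have "\<dots> \<le> \<gamma> * (norm (transpose A *v (Ht *v (e + (x - x')))))\<^sup>2" by (rule Q_le)
        also have "\<dots> = 2 * Q" by (simp add: Q_def tilde_diff matrix_vector_right_distrib e)
        finally show ?thesis .
      qed
      \<comment> \<open>\<open>psd_norm_le\<close> at \<open>e\<close> bounds the squared norm of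
        \<open>a\<close> by \<sigma> times the seminorm term, and \<open>s < 1\<close> weakens
        \<open>\<theta>2\<close> to \<open>\<theta> * \<sigma> \<le> \<rho>\<close>.\<close>
      have P: "\<theta> / \<rho> * (norm a)\<^sup>2 \<le> normsq Ht e"
      proof -
        have pos: "0 \<le> normsq Ht e" using Ht by (simp add: normsq_def sym_psd_def)
        have "\<theta> * (norm a)\<^sup>2 \<le> \<theta> * (\<sigma> * normsq Ht e)"
          using psd_norm_le[OF Ht \<sigma>_pos[unfolded \<sigma>_def], of e] \<theta> by (simp add: e \<sigma>_def)
        also have "\<dots> \<le> \<rho> * normsq Ht e"
        proof -
          have "\<theta> * \<sigma> \<le> \<rho>" using \<theta>2 s \<rho> by (smt (verit) mult_left_le_one_le)
          then show ?thesis using mult_right_mono[OF _ pos] by (simp add: mult.assoc[symmetric])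
        qed
        finally show ?thesis using \<rho> by (simp add: field_simps)
      qed
      define K where "K = \<theta> * (\<sigma> + \<rho>) / (1 - s) * (norm b)\<^sup>2"
      have K: "\<theta> / (1 + \<theta>) * (normsq Ht x' + \<rho> * (norm x')\<^sup>2) \<le> \<rho> * (norm (b - x'))\<^sup>2 + K"
      proof -
        have "\<theta> / (1 + \<theta>) * (normsq Ht x' + \<rho> * (norm x')\<^sup>2)
          \<le> \<theta> / (1 + \<theta>) * ((\<sigma> + \<rho>) * (norm x')\<^sup>2)"
          using \<theta> Ht_le[of x'] by (intro mult_left_mono) (auto simp: distrib_right)
        also have "\<dots> \<le> \<rho> * (norm (b - x'))\<^sup>2 + K"
          unfolding K_def using \<rho> \<theta> s \<sigma>_pos \<theta>2 by (intro contraction_young) auto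
        finally show ?thesis .
      qed
      \<comment> \<open>This is \<open>\<theta>3\<close> times the squared norm of \<open>y\<close>,
        divided by \<open>1 - s\<close>.\<close>
      have Kl: "K + \<theta> * \<rho> * normsq G y \<le> l * (norm y)\<^sup>2"
      proof -
        have "(norm b)\<^sup>2 \<le> (max_singular_value B)\<^sup>2 * (norm y)\<^sup>2"
          unfolding vars(6) power_mult_distrib[symmetric]
          by (intro power_mono norm_le_max_singular_value) simp
        then have "\<theta> * (\<sigma> + \<rho>) * (norm b)\<^sup>2 + (1 - s) * (\<theta> * \<rho>) * normsq G y
          \<le> \<theta> * (\<sigma> + \<rho>) * ((max_singular_value B)\<^sup>2 * (norm y)\<^sup>2)
            + (1 - s) * (\<theta> * \<rho>) * (max_singular_value G * (norm y)\<^sup>2)"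
          using \<theta> \<rho> \<sigma>_pos s by (intro add_mono mult_left_mono normsq_le_max_singular_value) auto
        also have "\<dots> = \<theta> * ((\<rho> + \<sigma>) * (max_singular_value B)\<^sup>2 + (1 - s) * \<rho> * max_singular_value G)
            * (norm y)\<^sup>2"
          by (simp add: algebra_simps)
        also have "\<dots> \<le> (1 - s) * l * (norm y)\<^sup>2"
          using \<theta>3 by (rule mult_right_mono) simp
        finally have "(1 - s) * (K + \<theta> * \<rho> * normsq G y) \<le> (1 - s) * (l * (norm y)\<^sup>2)"
          using s by (simp add: K_def distrib_left mult.assoc)
        then show ?thesis using s by simp
      qed
      \<comment> \<open>Eliminating \<phi> from either gap leaves this same expression, in which
        \<open>A *v w'\<close> appears as \<open>x' + B *v v + c\<close>.\<close>
      define R where "R = - Q - (a2 - \<alpha>) \<bullet> (x' + B *v v + c) + a2 \<bullet> (B *v v + c)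
        - \<alpha> \<bullet> (B *v v1 + c) + g1 - g0"
      have Aw': "A *v w' = x' + B *v v + c" by (simp add: vars)
      have Bv1: "B *v v1 = b + B *v v" by (simp add: vars matrix_vector_mult_diff_distrib)
      \<comment> \<open>Strong convexity is used at \<open>v1\<close> with the subgradient
        \<open>p\<close>. Rewriting its multiplier by the new \<open>a1\<close> produces the cross
        term in \<open>x - x'\<close>.\<close>
      have g_diff: "g1 - g0 \<le> a1 \<bullet> b - \<rho> * ((x - x') \<bullet> b) - \<rho> * (y \<bullet> (G *v (y - y'))) - l / 2 * (norm y)\<^sup>2"
      proof -
        define p where "p = transpose B *v (a' + \<rho> *\<^sub>R (A *v w' - B *v v1 - c)) - \<rho> *\<^sub>R (G *v (v1 - v'))"
        have "ereal (l / 2 * (norm (v1 - v))\<^sup>2) \<le> bregman g p v1 v"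
          using gstrong gsub unfolding strongly_convex_def p_def by blast
        then have "l / 2 * (norm y)\<^sup>2 \<le> g0 - g1 + p \<bullet> y"
          by (simp add: bregman_def g1 real vars(4) inner_diff_right)
        moreover have "a' + \<rho> *\<^sub>R (A *v w' - B *v v1 - c) = a1 - \<rho> *\<^sub>R (x - x')"
          unfolding a1 resid by (simp add: algebra_simps)
        then have "p \<bullet> y = a1 \<bullet> b - \<rho> * ((x - x') \<bullet> b) - \<rho> * (y \<bullet> (G *v (y - y')))"
          unfolding p_def
          by (simp only: inner_diff_left inner_matrix_vector_transpose[symmetric] vars(6)[symmetric]
              inner_scaleR_left) (simp add: vars(4,5) inner_commute)
        ultimately show ?thesis by simp
      qed
      have "R \<le> - Q - (a + Ht *v (x - x')) \<bullet> x' + a \<bullet> b - \<rho> * ((x - x') \<bullet> b)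
          - \<rho> * (y \<bullet> (G *v (y - y'))) - l / 2 * (norm y)\<^sup>2"
        using g_diff arg_cong[OF tilde_diff, of "\<lambda>u. u \<bullet> x'"] unfolding R_def Bv1 vars(1)
        by (simp add: inner_diff_left inner_add_left inner_add_right)
      also have "\<dots> \<le> \<delta> (t - 1) / (1 + \<theta>) - \<delta> t"
        using lyapunov_decrease[OF \<rho> \<theta> symHt G ax Q P K Kl, of y']
        unfolding \<delta> by (simp add: defs vars)
      finally have R_le: "R \<le> \<delta> (t - 1) / (1 + \<theta>) - \<delta> t" .
      have gdiff: "norm (gradient \<phi> w - gradient \<phi> w') = norm (transpose A *v (a2 - \<alpha>))"
        by (simp add: grad_w grad_w' matrix_vector_mult_diff_distrib)
      have "r t \<le> ereal R"
      proof -
        \<comment> \<open>Cocoercivity based at \<open>w'\<close>, where the gradient is given by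
          \<open>a2\<close>.\<close>
        have "\<phi> w' - a2 \<bullet> (A *v (w - w')) + Q \<le> \<phi> w"
          using smooth_convex_lower[OF \<gamma> conv smooth, of w' w] unfolding gdiff Q_def[symmetric]
          by (simp add: grad_w' inner_matrix_vector_transpose)
        then show ?thesis
          using r[OF t, folded defs] unfolding R_def Aw'[symmetric]
          by (simp add: g1 real matrix_vector_mult_diff_distrib inner_diff_right
              inner_diff_left inner_add_right)
      qed
      moreover have "rstar t \<le> ereal R"
      proof -
        \<comment> \<open>The same inequality with base point \<open>w\<close> and gradient given by
          \<alpha>; Fenchel equality at both points translates it to the conjugates.\<close>
        have "\<phi> w - \<alpha> \<bullet> (A *v (w' - w)) + Q \<le> \<phi> w'"
          using smooth_convex_lower[OF \<gamma> conv smooth, of w w']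
          unfolding norm_minus_commute[of "gradient \<phi> w'"] gdiff Q_def[symmetric]
          by (simp add: grad_w inner_matrix_vector_transpose)
        moreover have "convex_conjugate (\<lambda>x. ereal (\<phi> x)) (- (transpose A *v a2))
            = ereal (- (a2 \<bullet> (A *v w')) - \<phi> w')"
          using convex_conjugate_gradient[OF conv diff, of w']
          by (simp add: grad_w' inner_matrix_vector_transpose)
        moreover have "convex_conjugate (\<lambda>x. ereal (\<phi> x)) (- (transpose A *v \<alpha>))
            = ereal (- (\<alpha> \<bullet> (A *v w)) - \<phi> w)"
          using convex_conjugate_gradient[OF conv diff, of w]
          by (simp add: grad_w inner_matrix_vector_transpose)
        ultimately show ?thesis
          using rstar[OF t, folded defs] unfolding R_def Aw'[symmetric]
          by (simp add: g1 real matrix_vector_mult_diff_distrib inner_diff_right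
              inner_diff_left inner_add_right)
      qed
      ultimately show ?thesis using R_le by (meson ereal_less_eq(3) order.trans)
    qed
  qed
  then show ?thesis using \<theta> by (intro conjI weighted_sum_le_telescope) auto
qed

end
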